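(* Let $A$, $B$ and $C$ be Banach algebras and let $T_1:A\to B$ and $T_2:B\to C$ be bounded cf-homomorphisms [respectively bounded wcf-homomorphisms]. Then $T_2\circ T_1$ is a bounded cf-homomorphism [respectively a bounded wcf-homomorphism].
   Context: For a linear map $T:A\to B$ between Banach algebras, the failure of multiplicativity of $T$ is the bilinear map $S_T:A\times A\to B$, $S_T(a,b)=T(a)T(b)-T(ab)$. A bilinear map $S:E_1\times E_2\to F$ of normed spaces is compact [respectively weakly compact] if the norm closure [respectively weak closure] of $S(\{(x_1,x_2): \|x_1\|<1,\|x_2\|<1\})$ is norm compact [respectively weakly compact]. The linear map $T$ is a cf-homomorphism if $S_T$ is compact and a wcf-homomorphism if $S_T$ is weakly compact. *)

theory Defs
  imports "HOL-Analysis.Analysis"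
begin

text \<open>
  Banach algebras (not assumed unital or commutative) over a scalar field \<open>'k\<close>. Taking
  \<open>'k = real\<close> or \<open>'k = complex\<close> gives real and complex Banach algebras; the type classes
  on their own only provide multiplication by real scalars.
\<close>

locale banach_algebra = vector_space scale
  for scale :: "'k::real_normed_field \<Rightarrow> 'a::{real_normed_algebra,banach} \<Rightarrow> 'a" +
  assumes scale_of_real: "scale (of_real r) x = r *\<^sub>R x"
    and norm_scale: "norm (scale c x) = norm c * norm x"
    and scale_mult_left: "scale c x * y = scale c (x * y)"
    and scale_mult_right: "x * scale c y = scale c (x * y)"

lemma banach_algebra_real:
  "banach_algebra (scaleR :: real \<Rightarrow> 'a::{real_normed_algebra,banach} \<Rightarrow> 'a)"
  by unfold_locales (simp_all add: scaleR_add_right scaleR_add_left)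

lemma banach_algebra_complex:
  "banach_algebra ((*) :: complex \<Rightarrow> complex \<Rightarrow> complex)"
  by unfold_locales (simp_all add: algebra_simps norm_mult scaleR_conv_of_real)

definition bounded_operator ::
  "('k::real_normed_field \<Rightarrow> 'a::real_normed_vector \<Rightarrow> 'a) \<Rightarrow>
   ('k \<Rightarrow> 'b::real_normed_vector \<Rightarrow> 'b) \<Rightarrow> ('a \<Rightarrow> 'b) \<Rightarrow> bool" where
  "bounded_operator sA sB T \<longleftrightarrow>
     Vector_Spaces.linear sA sB T \<and> (\<exists>K. \<forall>x. norm (T x) \<le> K * norm x)"

text \<open>The coarsest topology making all bounded \<open>'k\<close>-linear functionals continuous.\<close>

definition weak_topology ::
  "('k::real_normed_field \<Rightarrow> 'a::real_normed_vector \<Rightarrow> 'a) \<Rightarrow> 'a topology" where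
  "weak_topology s =
     topology_generated_by {f -` U | f U. bounded_operator s (*) f \<and> open U}"

definition open_unit_ball_image ::
  "('a::real_normed_vector \<Rightarrow> 'b::real_normed_vector \<Rightarrow> 'c) \<Rightarrow> 'c set" where
  "open_unit_ball_image S = {S x y | x y. norm x < 1 \<and> norm y < 1}"

definition compact_bilinear ::
  "('a::real_normed_vector \<Rightarrow> 'b::real_normed_vector \<Rightarrow> 'c::real_normed_vector) \<Rightarrow> bool" where
  "compact_bilinear S \<longleftrightarrow> compact (closure (open_unit_ball_image S))"

definition weakly_compact_bilinear ::
  "('k::real_normed_field \<Rightarrow> 'c::real_normed_vector \<Rightarrow> 'c) \<Rightarrow>
   ('a::real_normed_vector \<Rightarrow> 'b::real_normed_vector \<Rightarrow> 'c) \<Rightarrow> bool" where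
  "weakly_compact_bilinear s S \<longleftrightarrow>
     compactin (weak_topology s) (weak_topology s closure_of open_unit_ball_image S)"

definition mult_failure ::
  "('a::real_normed_algebra \<Rightarrow> 'b::real_normed_algebra) \<Rightarrow> 'a \<Rightarrow> 'a \<Rightarrow> 'b" where
  "mult_failure T a b = T a * T b - T (a * b)"

definition cf_homomorphism ::
  "('k::real_normed_field \<Rightarrow> 'a::real_normed_algebra \<Rightarrow> 'a) \<Rightarrow>
   ('k \<Rightarrow> 'b::real_normed_algebra \<Rightarrow> 'b) \<Rightarrow> ('a \<Rightarrow> 'b) \<Rightarrow> bool" where
  "cf_homomorphism sA sB T \<longleftrightarrow>
     Vector_Spaces.linear sA sB T \<and> compact_bilinear (mult_failure T)"

definition wcf_homomorphism ::
  "('k::real_normed_field \<Rightarrow> 'a::real_normed_algebra \<Rightarrow> 'a) \<Rightarrow>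
   ('k \<Rightarrow> 'b::real_normed_algebra \<Rightarrow> 'b) \<Rightarrow> ('a \<Rightarrow> 'b) \<Rightarrow> bool" where
  "wcf_homomorphism sA sB T \<longleftrightarrow>
     Vector_Spaces.linear sA sB T \<and> weakly_compact_bilinear sB (mult_failure T)"

text \<open>
  The two compactness predicates do not themselves require bilinearity; for the maps to which
  they are applied it is automatic.
\<close>

lemma mult_failure_bilinear:
  assumes "banach_algebra sA" "banach_algebra sB" "Vector_Spaces.linear sA sB T"
  shows "Vector_Spaces.linear sA sB (\<lambda>a. mult_failure T a b)"
    and "Vector_Spaces.linear sA sB (mult_failure T a)"
proof -
  interpret A: banach_algebra sA by fact
  interpret B: banach_algebra sB by fact
  interpret T: Vector_Spaces.linear sA sB T by fact
  show "Vector_Spaces.linear sA sB (\<lambda>a. mult_failure T a b)"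
    by unfold_locales
      (simp_all add: mult_failure_def T.add T.scale A.scale_mult_left B.scale_mult_left
        B.scale_right_diff_distrib distrib_right)
  show "Vector_Spaces.linear sA sB (mult_failure T a)"
    by unfold_locales
      (simp_all add: mult_failure_def T.add T.scale A.scale_mult_right B.scale_mult_right
        B.scale_right_diff_distrib distrib_left)
qed

end

(*
  With S the failure of multiplicativity,
    S_{T2 o T1}(a, b) = S_{T2}(T1 a, T1 b) + T2 (S_{T1}(a, b)).
  If norm (T1 x) <= K norm x with K > 0, rescaling by K puts the image of the unit balls under
  S_{T2 o T1} inside K^2 L + T2 M, where L and M are the compact closures of the images under
  S_{T2} and S_{T1}. Addition, real scaling and T2 are continuous for the norm topologies as well
  as for the weak ones, so this set is compact. Both topologies are regular, and in a regular space
  a subset of a compact set has compact closure; this avoids Hahn-Banach, which would be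
  needed to see that the weak topology is Hausdorff.
*)
theory Submission imports Defs begin

text \<open>First the closure of \<open>K\<close> is shown compact. A finite subfamily
  \<open>\<F>\<close> of the cover already covers \<open>K\<close>, and regularity separates
  \<open>K\<close> from the closed complement of its union, so that the same \<open>\<F>\<close>
  covers the closure too.\<close>

lemma compactin_closure_of_subset:
  assumes "regular_space X" "compactin X K" "S \<subseteq> K"
  shows "compactin X (X closure_of S)"
proof -
  have "compactin X (X closure_of K)"
    unfolding compactin_def
  proof (intro conjI allI impI)
    fix \<U> assume \<U>: "Ball \<U> (openin X) \<and> X closure_of K \<subseteq> \<Union>\<U>"
    then have "K \<subseteq> \<Union>\<U>"
      using closure_of_subset[OF compactin_subset_topspace[OF assms(2)]] by blast
    with \<U> assms(2) obtain \<F> where \<F>: "finite \<F>" "\<F> \<subseteq> \<U>" "K \<subseteq> \<Union>\<F>"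
      unfolding compactin_def by meson
    have "closedin X (topspace X - \<Union>\<F>)"
      using \<U> \<F> by (intro closedin_diff openin_Union) auto
    moreover have "disjnt K (topspace X - \<Union>\<F>)"
      using \<F> by (auto simp: disjnt_iff)
    ultimately obtain U V where UV: "openin X U" "openin X V" "K \<subseteq> U"
      "topspace X - \<Union>\<F> \<subseteq> V" "disjnt U V"
      using regular_space_compact_closed_separation[OF assms(1,2)] by metis
    \<comment> \<open>The complement of \<open>V\<close> is closed, contains \<open>K\<close> and
      lies inside the union of \<open>\<F>\<close>.\<close>
    have "X closure_of K \<subseteq> topspace X - V"
      using UV openin_subset[OF UV(1)] by (intro closure_of_minimal) (auto simp: disjnt_iff)
    then show "\<exists>\<F>. finite \<F> \<and> \<F> \<subseteq> \<U> \<and> X closure_of K \<subseteq> \<Union>\<F>"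
      using UV \<F> by (intro exI[of _ \<F>]) blast
  qed (rule closure_of_subset_topspace)
  then show ?thesis
    using closed_compactin[OF _ closure_of_mono[OF assms(3)] closedin_closure_of] by blast
qed

text \<open>The scalars \<open>of_real r\<close> act as \<open>scaleR r\<close> on both sides, so
  linearity over the field restricts to the reals.\<close>

lemma banach_algebra_linear_real:
  assumes "banach_algebra sA" "banach_algebra sB" "Vector_Spaces.linear sA sB T"
  shows "linear T"
proof -
  interpret A: banach_algebra sA by fact
  interpret B: banach_algebra sB by fact
  interpret T: Vector_Spaces.linear sA sB T by fact
  show ?thesis
    by (rule linearI) (simp_all add: T.add T.scale flip: A.scale_of_real B.scale_of_real)
qed

text \<open>The terms \<open>T2 (T1 a * T1 b)\<close> cancel on the right-hand side.\<close>

lemma mult_failure_comp: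
  assumes "linear T2"
  shows "mult_failure (T2 \<circ> T1) a b = mult_failure T2 (T1 a) (T1 b) + T2 (mult_failure T1 a b)"
  by (simp add: mult_failure_def linear_diff[OF assms])

lemma mult_failure_scaleR:
  assumes "linear T"
  shows "mult_failure T (r *\<^sub>R a) (r *\<^sub>R b) = (r * r) *\<^sub>R mult_failure T a b"
  by (simp add: mult_failure_def linear_scale[OF assms] scaleR_diff_right)

text \<open>The topologies are kept abstract so that one argument serves both the norm and the weak
  case. Boundedness of \<open>T1\<close> enters only through the norm, since the unit balls are norm
  balls in either case.\<close>

lemma compactin_closure_of_mult_failure_comp:
  fixes T1 :: "'a::real_normed_algebra \<Rightarrow> 'b::real_normed_algebra"
    and T2 :: "'b \<Rightarrow> 'c::real_normed_algebra"
  assumes T1: "\<And>x. norm (T1 x) \<le> K * norm x" and T2: "linear T2"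
    and top: "topspace X = UNIV" "topspace Y = UNIV" and reg: "regular_space Y"
    and cont: "continuous_map X Y T2"
    and add: "continuous_map (prod_topology Y Y) Y (\<lambda>p. fst p + snd p)"
    and scale: "\<And>r. continuous_map Y Y (scaleR r)"
    and cpt: "compactin X (X closure_of open_unit_ball_image (mult_failure T1))"
      "compactin Y (Y closure_of open_unit_ball_image (mult_failure T2))"
  shows "compactin Y (Y closure_of open_unit_ball_image (mult_failure (T2 \<circ> T1)))"
proof -
  define M where "M = X closure_of open_unit_ball_image (mult_failure T1)"
  define L where "L = Y closure_of open_unit_ball_image (mult_failure T2)"
  have M: "open_unit_ball_image (mult_failure T1) \<subseteq> M"
    unfolding M_def by (rule closure_of_subset) (simp add: top)
  have L: "open_unit_ball_image (mult_failure T2) \<subseteq> L"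
    unfolding L_def by (rule closure_of_subset) (simp add: top)
  \<comment> \<open>\<open>K\<close> may be zero or negative; the maximum gives a bound by which one
    can divide.\<close>
  define k where "k = max K 1"
  have k: "k > 0" "norm (T1 x) \<le> k * norm x" for x
    using order_trans[OF T1[of x] mult_right_mono[of K k "norm x"]] by (auto simp: k_def)
  \<comment> \<open>The factor is \<open>k * k\<close> because both arguments of
    \<open>mult_failure T2\<close> are shrunk by \<open>k\<close> to enter the unit ball.\<close>
  define N where "N = (\<lambda>p. fst p + snd p) ` ((scaleR (k * k) ` L) \<times> (T2 ` M))"
  have "compactin Y (scaleR (k * k) ` L)" "compactin Y (T2 ` M)"
    using cpt scale cont unfolding L_def M_def by (blast intro: image_compactin)+
  then have "compactin Y N"
    unfolding N_def by (intro image_compactin[OF _ add]) (simp add: compactin_Times)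
  moreover have "open_unit_ball_image (mult_failure (T2 \<circ> T1)) \<subseteq> N"
  proof (clarsimp simp: open_unit_ball_image_def)
    fix a b :: 'a assume ab: "norm a < 1" "norm b < 1"
    have ball: "norm ((1 / k) *\<^sub>R T1 x) < 1" if "norm x < 1" for x
      using order_le_less_trans[OF k(2)[of x], of k] mult_strict_left_mono[OF that k(1)] k(1)
      by (simp add: divide_simps)
    define u where "u = mult_failure T2 ((1 / k) *\<^sub>R T1 a) ((1 / k) *\<^sub>R T1 b)"
    have "u \<in> L"
      using L ball[OF ab(1)] ball[OF ab(2)] unfolding u_def open_unit_ball_image_def by blast
    moreover have "mult_failure T1 a b \<in> M"
      using M ab unfolding open_unit_ball_image_def by blast
    moreover have "mult_failure T2 (T1 a) (T1 b) = (k * k) *\<^sub>R u"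
      using k(1) mult_failure_scaleR[OF T2, of k "(1 / k) *\<^sub>R T1 a" "(1 / k) *\<^sub>R T1 b"]
      by (simp add: u_def)
    ultimately show "mult_failure (T2 \<circ> T1) a b \<in> N"
      unfolding N_def mult_failure_comp[OF T2] by force
  qed
  ultimately show ?thesis
    using reg by (blast intro: compactin_closure_of_subset)
qed

lemma bounded_operator_compose:
  assumes "bounded_operator sA sB T1" "bounded_operator sB sC T2"
  shows "bounded_operator sA sC (T2 \<circ> T1)"
proof -
  obtain K1 K2 where K: "\<And>x. norm (T1 x) \<le> K1 * norm x" "\<And>x. norm (T2 x) \<le> K2 * norm x"
    using assms unfolding bounded_operator_def by metis
  \<comment> \<open>The absolute value makes multiplication by the constant monotone, as the sign of
    \<open>K2\<close> is unknown.\<close>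
  have "norm (T2 (T1 x)) \<le> (\<bar>K2\<bar> * K1) * norm x" for x
  proof -
    have "norm (T2 (T1 x)) \<le> \<bar>K2\<bar> * norm (T1 x)"
      using order_trans[OF K(2)] by (simp add: mult_right_mono)
    also have "\<dots> \<le> \<bar>K2\<bar> * (K1 * norm x)"
      by (rule mult_left_mono[OF K(1)]) simp
    finally show ?thesis by simp
  qed
  moreover have "Vector_Spaces.linear sA sC (T2 \<circ> T1)"
    using assms unfolding bounded_operator_def by (blast intro: Vector_Spaces.linear_compose)
  ultimately show ?thesis
    unfolding bounded_operator_def comp_apply by blast
qed

text \<open>Real scaling is the action of the scalar \<open>of_real r\<close>, which commutes with
  every other scalar. Being a bounded operator, it is then weakly continuous.\<close>

lemma bounded_operator_scaleR:
  assumes "banach_algebra s"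
  shows "bounded_operator s s (scaleR r)"
proof -
  interpret banach_algebra s by fact
  have "Vector_Spaces.linear s s (scaleR r)"
    by unfold_locales (simp_all add: scale_right_distrib mult.commute flip: scale_of_real)
  then show ?thesis
    unfolding bounded_operator_def by (auto intro: exI[of _ "\<bar>r\<bar>"])
qed

lemma topspace_weak_topology:
  assumes "banach_algebra s"
  shows "topspace (weak_topology s) = UNIV"
proof -
  interpret banach_algebra s by fact
  \<comment> \<open>The zero functional puts the whole space among the generating sets.\<close>
  have "Vector_Spaces.linear s (*) (\<lambda>x. 0)"
    by unfold_locales (simp_all add: algebra_simps)
  then have "bounded_operator s (*) (\<lambda>x. 0)"
    unfolding bounded_operator_def by (auto intro: exI[of _ 0])
  then have "(\<lambda>x. 0) -` UNIV \<in> {f -` U | f U. bounded_operator s (*) f \<and> open U}"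
    by blast
  then show ?thesis
    unfolding weak_topology_def topology_generated_by_topspace by auto
qed

lemma continuous_map_weak_topology_functional:
  fixes f :: "'a::{real_normed_algebra,banach} \<Rightarrow> 'k::real_normed_field"
  assumes "banach_algebra s" "bounded_operator s (*) f"
  shows "continuous_map (weak_topology s) euclidean f"
  unfolding continuous_map_def topspace_weak_topology[OF assms(1)]
proof (intro conjI allI impI)
  fix U :: "'k set" assume "openin euclidean U"
  then have "openin (weak_topology s) (f -` U)"
    unfolding weak_topology_def
    using assms(2) by (intro topology_generated_by_Basis) auto
  then show "openin (weak_topology s) {x \<in> UNIV. f x \<in> U}"
    by (simp add: vimage_def)
qed simp

text \<open>This is the universal property of an initial topology: continuity need only be tested on
  preimages of the generating sets.\<close>

lemma continuous_map_into_weak_topology: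
  assumes "banach_algebra s"
    and "\<And>f. bounded_operator s (*) f \<Longrightarrow> continuous_map X euclidean (f \<circ> g)"
  shows "continuous_map X (weak_topology s) g"
  unfolding weak_topology_def
proof (rule continuous_on_generated_topo)
  fix V assume "V \<in> {f -` U | f U. bounded_operator s (*) f \<and> open U}"
  then obtain f U where fU: "V = f -` U" "bounded_operator s (*) f" "open U" by blast
  have "g -` V \<inter> topspace X = {x \<in> topspace X. (f \<circ> g) x \<in> U}"
    using fU by auto
  then show "openin X (g -` V \<inter> topspace X)"
    using openin_continuous_map_preimage[OF assms(2)[OF fU(2)], of U] fU by simp
next
  show "g ` topspace X \<subseteq> \<Union>{f -` U | f U. bounded_operator s (*) f \<and> open U}"
    using topspace_weak_topology[OF assms(1)]
    unfolding weak_topology_def topology_generated_by_topspace by simp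
qed

text \<open>Composing a bounded functional with \<open>T\<close> gives a bounded functional
  again.\<close>

lemma continuous_map_weak_topology:
  assumes "banach_algebra sA" "banach_algebra sB" "bounded_operator sA sB T"
  shows "continuous_map (weak_topology sA) (weak_topology sB) T"
  using assms
  by (blast intro: continuous_map_into_weak_topology continuous_map_weak_topology_functional
      bounded_operator_compose)

lemma continuous_map_weak_topology_add:
  assumes "banach_algebra s"
  shows "continuous_map (prod_topology (weak_topology s) (weak_topology s)) (weak_topology s)
    (\<lambda>p. fst p + snd p)"
proof (rule continuous_map_into_weak_topology[OF assms])
  fix f assume f: "bounded_operator s (*) f"
  then interpret f: Vector_Spaces.linear s "(*)" f by (simp add: bounded_operator_def)
  note cont = continuous_map_weak_topology_functional[OF assms f]
  \<comment> \<open>Additivity of \<open>f\<close> moves the question to addition in the scalar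
    field.\<close>
  have "f \<circ> (\<lambda>p. fst p + snd p) = (\<lambda>p. (f \<circ> fst) p + (f \<circ> snd) p)"
    by (auto simp: f.add)
  then show "continuous_map (prod_topology (weak_topology s) (weak_topology s)) euclidean
      (f \<circ> (\<lambda>p. fst p + snd p))"
    by (auto intro!: continuous_map_add continuous_map_compose[OF _ cont]
        continuous_map_fst continuous_map_snd simp del: o_apply)
qed

text \<open>Regularity is proved as the existence of small closed neighbourhoods, by induction on
  how an open set is generated. The property passes through finite intersections and unions, and for
  a generating set it is pulled back from the scalar field.\<close>

lemma regular_space_weak_topology:
  assumes s: "banach_algebra s"
  shows "regular_space (weak_topology s)"
proof -
  let ?X = "weak_topology s"
  have "\<exists>U V. openin ?X U \<and> closedin ?X V \<and> x \<in> U \<and> U \<subseteq> V \<and> V \<subseteq> W"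
    if "openin ?X W" "x \<in> W" for W x
    using openin_topology_generated_by[OF that(1)[unfolded weak_topology_def]] that(2)
  proof (induction rule: generate_topology_on.induct)
    case (Int a b)
    then obtain U V U' V' where "openin ?X U" "closedin ?X V" "x \<in> U" "U \<subseteq> V" "V \<subseteq> a"
      "openin ?X U'" "closedin ?X V'" "x \<in> U'" "U' \<subseteq> V'" "V' \<subseteq> b"
      by (metis IntD1 IntD2)
    then show ?case
      by (intro exI[of _ "U \<inter> U'"] exI[of _ "V \<inter> V'"]) auto
  next
    case (UN K)
    then obtain k where "k \<in> K" "x \<in> k" by blast
    with UN.IH[OF this] show ?case by blast
  next
    case (Basis W)
    then obtain f G where W: "W = f -` G" "bounded_operator s (*) f" "open G" by blast
    note cont = continuous_map_weak_topology_functional[OF s W(2)]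
    obtain e where e: "e > 0" "cball (f x) e \<subseteq> G"
      using W(1,3) Basis.prems open_contains_cball by blast
    \<comment> \<open>Open and closed balls of the same radius in the scalar field pull back to the
      required nested pair.\<close>
    have "openin ?X (f -` ball (f x) e)" "closedin ?X (f -` cball (f x) e)"
      using openin_continuous_map_preimage[OF cont, of "ball (f x) e"]
        closedin_continuous_map_preimage[OF cont, of "cball (f x) e"]
      by (simp_all add: topspace_weak_topology[OF s] vimage_def)
    then show ?case
      using e W(1) by (intro exI[of _ "f -` ball (f x) e"] exI[of _ "f -` cball (f x) e"]) auto
  qed simp
  then show ?thesis
    unfolding neighbourhood_base_of_closedin[symmetric] neighbourhood_base_of by blast
qed

theorem theorem2p11:
  fixes sA :: "'k::real_normed_field \<Rightarrow> 'a::{real_normed_algebra,banach} \<Rightarrow> 'a"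
    and sB :: "'k \<Rightarrow> 'b::{real_normed_algebra,banach} \<Rightarrow> 'b"
    and sC :: "'k \<Rightarrow> 'c::{real_normed_algebra,banach} \<Rightarrow> 'c"
    and T1 :: "'a \<Rightarrow> 'b" and T2 :: "'b \<Rightarrow> 'c"
  assumes "banach_algebra sA" and "banach_algebra sB" and "banach_algebra sC"
    and "bounded_operator sA sB T1" and "bounded_operator sB sC T2"
  shows "(cf_homomorphism sA sB T1 \<and> cf_homomorphism sB sC T2 \<longrightarrow>
            bounded_operator sA sC (T2 \<circ> T1) \<and> cf_homomorphism sA sC (T2 \<circ> T1)) \<and>
         (wcf_homomorphism sA sB T1 \<and> wcf_homomorphism sB sC T2 \<longrightarrow>
            bounded_operator sA sC (T2 \<circ> T1) \<and> wcf_homomorphism sA sC (T2 \<circ> T1))"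
proof -
  note A = assms(1) and B = assms(2) and C = assms(3)
  have bdd: "bounded_operator sA sC (T2 \<circ> T1)"
    using assms(4,5) by (rule bounded_operator_compose)
  then have lin: "Vector_Spaces.linear sA sC (T2 \<circ> T1)"
    by (simp add: bounded_operator_def)
  obtain K where K: "\<And>x. norm (T1 x) \<le> K * norm x"
    using assms(4) unfolding bounded_operator_def by blast
  have T2: "linear T2"
    using banach_algebra_linear_real[OF B C] assms(5) by (simp add: bounded_operator_def)
  obtain K2 where "\<And>x. norm (T2 x) \<le> K2 * norm x"
    using assms(5) unfolding bounded_operator_def by blast
  then have "bounded_linear T2"
    using T2 by (intro bounded_linear_intro[of T2 K2])
      (simp_all add: linear_add linear_scale mult.commute)
  then have cont: "continuous_map euclidean euclidean T2"
    by (simp add: linear_continuous_on)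
  have add: "continuous_map (prod_topology euclidean euclidean) euclidean
      (\<lambda>p. fst p + snd p :: 'c)"
    by (intro continuous_map_add continuous_map_fst continuous_map_snd)
  \<comment> \<open>The norm case takes both abstract topologies to be \<open>euclidean\<close>, the
    weak case below takes the two weak topologies.\<close>
  have "compact_bilinear (mult_failure (T2 \<circ> T1))"
    if "compact_bilinear (mult_failure T1)" "compact_bilinear (mult_failure T2)"
    using compactin_closure_of_mult_failure_comp
      [OF K T2 topspace_euclidean topspace_euclidean regular_space_euclidean cont add] that
    by (simp add: compact_bilinear_def continuous_on_scaleR)
  moreover have "weakly_compact_bilinear sC (mult_failure (T2 \<circ> T1))"
    if "weakly_compact_bilinear sB (mult_failure T1)" "weakly_compact_bilinear sC (mult_failure T2)"
    using that unfolding weakly_compact_bilinear_def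
    by (rule compactin_closure_of_mult_failure_comp[OF K T2 topspace_weak_topology[OF B]
          topspace_weak_topology[OF C] regular_space_weak_topology[OF C]
          continuous_map_weak_topology[OF B C assms(5)] continuous_map_weak_topology_add[OF C]
          continuous_map_weak_topology[OF C C bounded_operator_scaleR[OF C]]])
  ultimately show ?thesis
    using bdd lin unfolding cf_homomorphism_def wcf_homomorphism_def by blast
qed

end
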